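(* Let $K$ be a field of characteristic $0$, let $n\geq 1$, let $X=\{x_1,\ldots,x_n\}$, $Y=\{y_1,\ldots,y_n\}$, and let $\Delta$ be the derivation of the polynomial algebra $K[X,Y]=K[x_1,\ldots,x_n,y_1,\ldots,y_n]$ defined by \[ \Delta=\sum_{i=1}^n x_i\frac{\partial}{\partial y_i}. \] Then the algebra of constants $K[X,Y]^{\Delta}$ is generated, as a $K$-algebra, by the elements \[ x_i,\quad i=1,\ldots,n,\qquad u_{ij}=x_iy_j-x_jy_i,\quad 1\leq i<j\leq n. \]
   Context: $K[X,Y]$ is the commutative polynomial algebra in the $2n$ variables $x_1,\ldots,x_n,y_1,\ldots,y_n$. The derivation $\Delta$ is $K$-linear, satisfies the Leibniz rule, and acts on variables by $\Delta(x_i)=0$, $\Delta(y_i)=x_i$. The algebra of constants of $\Delta$ is its kernel $K[X,Y]^{\Delta}=\{f\in K[X,Y] : \Delta(f)=0\}$. *)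

theory Defs
  imports Complex_Main "HOL-Library.Poly_Mapping"
begin

datatype var = XV nat | YV nat

text \<open>
  Polynomials are finitely supported maps from monomials (finitely supported exponent functions)
  to coefficients, with convolution as multiplication. The type provides the variables
  \<open>x\<^sub>i\<close>, \<open>y\<^sub>i\<close> for all natural \<open>i\<close>; the ring \<open>K[X,Y]\<close> in \<open>2n\<close> variables is the subring \<open>KXY n\<close>
  of those polynomials in which only the variables with \<open>1 \<le> i \<le> n\<close> occur.
\<close>

type_synonym 'k mpoly = "(var \<Rightarrow>\<^sub>0 nat) \<Rightarrow>\<^sub>0 'k"

definition Const :: "'k::zero \<Rightarrow> 'k mpoly" where
  "Const c = Poly_Mapping.single 0 c"

definition Var :: "var \<Rightarrow> 'k::zero_neq_one mpoly" where
  "Var v = Poly_Mapping.single (Poly_Mapping.single v 1) 1"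

abbreviation xvar :: "nat \<Rightarrow> 'k::zero_neq_one mpoly" where
  "xvar i \<equiv> Var (XV i)"

abbreviation yvar :: "nat \<Rightarrow> 'k::zero_neq_one mpoly" where
  "yvar i \<equiv> Var (YV i)"

definition KXY :: "nat \<Rightarrow> 'k::zero mpoly set" where
  "KXY n = {p. \<forall>m \<in> Poly_Mapping.keys p. Poly_Mapping.keys m \<subseteq> XV ` {1..n} \<union> YV ` {1..n}}"

text \<open>
  The formal partial derivative. If \<open>v\<close> does not occur in the monomial \<open>m\<close>, the exponent
  \<open>m - single v 1\<close> is truncated, but the coefficient is then \<open>0\<close>.
\<close>

definition partial :: "var \<Rightarrow> 'k::semiring_1 mpoly \<Rightarrow> 'k mpoly" where
  "partial v p =
    (\<Sum>m \<in> Poly_Mapping.keys p. Poly_Mapping.single (m - Poly_Mapping.single v 1)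
      (of_nat (Poly_Mapping.lookup m v) * Poly_Mapping.lookup p m))"

definition Delta :: "nat \<Rightarrow> 'k::comm_ring_1 mpoly \<Rightarrow> 'k mpoly" where
  "Delta n f = (\<Sum>i = 1..n. xvar i * partial (YV i) f)"

definition constants :: "nat \<Rightarrow> 'k::comm_ring_1 mpoly set" where
  "constants n = {f \<in> KXY n. Delta n f = 0}"

definition uelem :: "nat \<Rightarrow> nat \<Rightarrow> 'k::comm_ring_1 mpoly" where
  "uelem i j = xvar i * yvar j - xvar j * yvar i"

text \<open>
  Unital subalgebras over the coefficients; scalar multiplication and negation are products with
  constant polynomials.
\<close>

definition subalgebra :: "'k::comm_ring_1 mpoly set \<Rightarrow> bool" where
  "subalgebra A \<longleftrightarrow> range Const \<subseteq> A \<and> (\<forall>p \<in> A. \<forall>q \<in> A. p + q \<in> A \<and> p * q \<in> A)"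

lemma partial_superset:
  assumes "finite M" "Poly_Mapping.keys p \<subseteq> M"
  shows "partial v p =
    (\<Sum>m \<in> M. Poly_Mapping.single (m - Poly_Mapping.single v 1)
      (of_nat (Poly_Mapping.lookup m v) * Poly_Mapping.lookup p m))"
  unfolding partial_def
  by (rule sum.mono_neutral_left) (use assms in \<open>auto simp: in_keys_iff\<close>)

lemma partial_add: "partial v (p + q) = partial v p + partial v q"
  using partial_superset[of "Poly_Mapping.keys p \<union> Poly_Mapping.keys q" p v]
    partial_superset[of "Poly_Mapping.keys p \<union> Poly_Mapping.keys q" q v]
    partial_superset[of "Poly_Mapping.keys p \<union> Poly_Mapping.keys q" "p + q" v] Poly_Mapping.keys_add[of p q]
  by (simp add: lookup_add distrib_left single_add sum.distrib)

lemma partial_single: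
  "partial v (Poly_Mapping.single m c) =
    Poly_Mapping.single (m - Poly_Mapping.single v 1) (of_nat (Poly_Mapping.lookup m v) * c)"
  by (cases "c = 0") (simp_all add: partial_def)

lemma partial_zero [simp]: "partial v 0 = 0"
  by (simp add: partial_def)

lemma mpoly_induct [case_names zero add]:
  assumes "P 0" "\<And>m c p. P p \<Longrightarrow> P (Poly_Mapping.single m c + p)"
  shows "P (p :: 'k::comm_monoid_add mpoly)"
proof (induction p rule: update_induct)
  case (update f a b)
  have "Poly_Mapping.update a b f = Poly_Mapping.single a b + f"
    using update(1)
    by (intro poly_mapping_eqI) (auto simp: lookup_update lookup_add lookup_single in_keys_iff when_def)
  then show ?case using assms(2) update by simp
qed (rule assms)

lemma partial_mult_single:
  fixes c d :: "'k::comm_semiring_1"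
  shows "partial v (Poly_Mapping.single m c * Poly_Mapping.single k d) =
    partial v (Poly_Mapping.single m c) * Poly_Mapping.single k d +
    Poly_Mapping.single m c * partial v (Poly_Mapping.single k d)"
proof -
  let ?e = "Poly_Mapping.single v (1::nat)"
  have shift: "a - ?e + b = a + b - ?e" if "Poly_Mapping.lookup a v \<noteq> 0" for a b :: "var \<Rightarrow>\<^sub>0 nat"
    using that by (intro poly_mapping_eqI) (auto simp: lookup_add lookup_minus lookup_single when_def)
  have *: "Poly_Mapping.single (a - ?e + b) (of_nat (Poly_Mapping.lookup a v) * z) =
      Poly_Mapping.single (a + b - ?e) (of_nat (Poly_Mapping.lookup a v) * z)" for a b and z :: 'k
    by (cases "Poly_Mapping.lookup a v = 0") (simp_all only: shift of_nat_0 mult_zero_left single_zero not_False_eq_True)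
  have "Poly_Mapping.single (m + (k - ?e)) (c * (of_nat (Poly_Mapping.lookup k v) * d)) =
      Poly_Mapping.single (m + k - ?e) (of_nat (Poly_Mapping.lookup k v) * (c * d))"
    using *[of k m "c * d"] by (simp add: add.commute mult.left_commute)
  moreover have "Poly_Mapping.single (m - ?e + k) (of_nat (Poly_Mapping.lookup m v) * c * d) =
      Poly_Mapping.single (m + k - ?e) (of_nat (Poly_Mapping.lookup m v) * (c * d))"
    using *[of m k "c * d"] by (simp add: mult.assoc)
  ultimately show ?thesis
    by (simp add: partial_single mult_single lookup_add distrib_right flip: single_add)
qed

lemma partial_mult:
  fixes p q :: "'k::comm_semiring_1 mpoly"
  shows "partial v (p * q) = partial v p * q + p * partial v q"
proof (induction p rule: mpoly_induct)
  case (add m c p)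
  have "partial v (Poly_Mapping.single m c * q) =
      partial v (Poly_Mapping.single m c) * q + Poly_Mapping.single m c * partial v q"
    by (induction q rule: mpoly_induct)
      (simp_all add: distrib_left partial_add partial_mult_single ac_simps)
  then show ?case using add by (simp only: distrib_right distrib_left partial_add ac_simps)
qed simp

lemma partial_Const [simp]: "partial v (Const c) = 0"
  by (simp add: Const_def partial_single)

lemma partial_Var: "partial v (Var w) = (if v = w then 1 else 0)"
  by (auto simp: Var_def partial_single lookup_single)

lemma Delta_add: "Delta n (f + g) = Delta n f + Delta n g"
  by (simp add: Delta_def partial_add distrib_left sum.distrib)

lemma Delta_mult: "Delta n (f * g) = Delta n f * g + f * Delta n g"
  by (simp add: Delta_def partial_mult algebra_simps sum.distrib sum_distrib_left)

lemma Delta_Const [simp]: "Delta n (Const c) = 0"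
  by (simp add: Delta_def)

lemma Delta_x [simp]: "Delta n (xvar i) = 0"
  by (simp add: Delta_def partial_Var)

lemma Delta_y [simp]: "i \<in> {1..n} \<Longrightarrow> Delta n (yvar i) = xvar i"
  by (simp add: Delta_def partial_Var if_distrib[of "(*) _"] cong: if_cong)

end

theory Submission
  imports Defs
begin

text \<open>
  Let \<open>\<Omega>\<^sub>i\<^sub>j = \<partial>/\<partial>x\<^sub>i \<partial>/\<partial>y\<^sub>j - \<partial>/\<partial>x\<^sub>j \<partial>/\<partial>y\<^sub>i\<close>. These operators commute with \<open>\<Delta>\<close>, and Capelli's
  identity says that \<open>\<Sum>\<^sub>i\<^sub>,\<^sub>j u\<^sub>i\<^sub>j \<Omega>\<^sub>i\<^sub>j f = 2 (a + 1) b f\<close> whenever \<open>\<Delta> f = 0\<close> and \<open>f\<close> is bihomogeneous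
  of degree \<open>a\<close> in \<open>X\<close> and \<open>b\<close> in \<open>Y\<close>. As \<open>\<Omega>\<^sub>i\<^sub>j f\<close> is again a constant, of degree \<open>b - 1\<close> in \<open>Y\<close>,
  induction on \<open>b\<close> puts every bihomogeneous constant into the subalgebra; for \<open>b = 0\<close> it is a
  polynomial in \<open>X\<close>. Finally, the bihomogeneous components of a constant are constants.
\<close>

subsection \<open>Subalgebras\<close>

lemma subalgebra_hull: "subalgebra (subalgebra hull S)"
  by (rule hull_in) (auto simp: subalgebra_def)

context
  fixes A :: "'k::comm_ring_1 mpoly set"
  assumes A: "subalgebra A"
begin

lemma subalgebra_Const: "Const c \<in> A"
  using A by (auto simp: subalgebra_def)

lemma subalgebra_add: "p \<in> A \<Longrightarrow> q \<in> A \<Longrightarrow> p + q \<in> A"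
  using A by (auto simp: subalgebra_def)

lemma subalgebra_mult: "p \<in> A \<Longrightarrow> q \<in> A \<Longrightarrow> p * q \<in> A"
  using A by (auto simp: subalgebra_def)

lemma subalgebra_0: "0 \<in> A"
  using subalgebra_Const[of 0] by (simp add: Const_def)

lemma subalgebra_1: "1 \<in> A"
  using subalgebra_Const[of 1] by (simp add: Const_def)

lemma subalgebra_uminus: "p \<in> A \<Longrightarrow> - p \<in> A"
  using subalgebra_mult[OF subalgebra_Const[of "-1"], of p] by (simp add: Const_def single_uminus)

lemma subalgebra_sum: "(\<And>i. i \<in> I \<Longrightarrow> g i \<in> A) \<Longrightarrow> sum g I \<in> A"
  by (induction I rule: infinite_finite_induct) (auto intro: subalgebra_0 subalgebra_add)

lemma subalgebra_power: "p \<in> A \<Longrightarrow> p ^ k \<in> A"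
  by (induction k) (auto intro: subalgebra_1 subalgebra_mult)

end

lemma single_single_eq_Var_power:
  "Poly_Mapping.single (Poly_Mapping.single v k) 1 = (Var v :: 'k::comm_ring_1 mpoly) ^ k"
proof (induction k)
  case (Suc k)
  have "Poly_Mapping.single v (Suc k) = Poly_Mapping.single v 1 + Poly_Mapping.single v k"
    by (simp flip: single_add)
  then have "Poly_Mapping.single (Poly_Mapping.single v (Suc k)) 1 =
      Var v * Poly_Mapping.single (Poly_Mapping.single v k) (1 :: 'k)"
    by (simp only: Var_def mult_single mult_1)
  then show ?case
    by (simp only: Suc power_Suc)
qed simp

lemma monomial_in_subalgebra:
  fixes A :: "'k::comm_ring_1 mpoly set"
  assumes A: "subalgebra A" and "\<And>v. v \<in> Poly_Mapping.keys m \<Longrightarrow> Var v \<in> A"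
  shows "Poly_Mapping.single m 1 \<in> A"
  using assms(2)
proof (induction m rule: update_induct)
  case const
  then show ?case using subalgebra_1[OF A] by simp
next
  case (update m v k)
  have "Poly_Mapping.update v k m = Poly_Mapping.single v k + m"
    using update(1)
    by (intro poly_mapping_eqI) (auto simp: lookup_update lookup_add lookup_single in_keys_iff when_def)
  then have "Poly_Mapping.single (Poly_Mapping.update v k m) 1 =
      Var v ^ k * Poly_Mapping.single m (1 :: 'k)"
    by (simp add: mult_single flip: single_single_eq_Var_power)
  moreover have "Var v \<in> A" "Poly_Mapping.single m 1 \<in> A"
    using update by (auto simp: in_keys_iff lookup_update split: if_splits)
  ultimately show ?case
    using A by (simp add: subalgebra_mult subalgebra_power)
qed

lemma polynomial_in_subalgebra:
  fixes p :: "'k::comm_ring_1 mpoly"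
  assumes A: "subalgebra A"
    and "\<And>m v. m \<in> Poly_Mapping.keys p \<Longrightarrow> v \<in> Poly_Mapping.keys m \<Longrightarrow> Var v \<in> A"
  shows "p \<in> A"
proof -
  have "p = (\<Sum>m\<in>Poly_Mapping.keys p. Const (Poly_Mapping.lookup p m) * Poly_Mapping.single m 1)"
    by (intro poly_mapping_eqI)
      (auto simp: Const_def mult_single lookup_sum lookup_single when_def in_keys_iff
        if_distrib sum.If_cases cong: if_cong)
  also have "\<dots> \<in> A"
    using assms by (intro subalgebra_sum subalgebra_mult subalgebra_Const monomial_in_subalgebra) auto
  finally show ?thesis .
qed

subsection \<open>Partial derivatives\<close>

lemma partial_sum:
  fixes g :: "'a \<Rightarrow> 'k::comm_ring_1 mpoly"
  shows "partial v (sum g I) = (\<Sum>i\<in>I. partial v (g i))"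
  by (induction I rule: infinite_finite_induct) (auto simp: partial_add)

lemma partial_commute:
  fixes p :: "'k::comm_ring_1 mpoly"
  shows "partial v (partial w p) = partial w (partial v p)"
proof (induction p rule: mpoly_induct)
  case (add m c p)
  have "m - Poly_Mapping.single w 1 - Poly_Mapping.single v 1 =
      m - Poly_Mapping.single v 1 - Poly_Mapping.single w (1::nat)"
    by (intro poly_mapping_eqI) (simp add: lookup_minus)
  then have "partial v (partial w (Poly_Mapping.single m c)) =
      partial w (partial v (Poly_Mapping.single m c))"
    by (cases "v = w") (simp_all add: partial_single lookup_minus lookup_single mult.left_commute)
  then show ?case using add by (simp add: partial_add)
qed simp

section \<open>Commutators of \<open>Delta\<close> with the partial derivatives\<close>

lemma Delta_zero [simp]: "Delta n 0 = 0"
  by (simp add: Delta_def)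

lemma Delta_diff: "Delta n (f - g) = Delta n f - Delta n g"
  using Delta_add[of n "f - g" g] by simp

lemma partial_y_Delta: "partial (YV j) (Delta n f) = Delta n (partial (YV j) f)"
  by (simp add: Delta_def partial_sum partial_mult partial_Var partial_commute[of "YV j"])

text \<open>By the Leibniz rule the extra term arises where the derivative hits the coefficient
  \<open>xvar j\<close> of \<open>Delta\<close>. This commutator is what makes the two terms of
  \<open>Omega\<close> balance, and it also supplies the \<open>+ 1\<close> in Capelli's
  factor.\<close>

lemma partial_x_Delta:
  assumes "j \<in> {1..n}"
  shows "partial (XV j) (Delta n f) = Delta n (partial (XV j) f) + partial (YV j) f"
proof -
  have "partial (XV j) (Delta n f) =
      (\<Sum>i = 1..n. (if j = i then partial (YV i) f else 0) + xvar i * partial (YV i) (partial (XV j) f))"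
    by (auto simp: Delta_def partial_sum partial_mult partial_Var partial_commute[of "XV j"]
        intro!: sum.cong)
  then show ?thesis
    using assms by (simp add: sum.distrib Delta_def)
qed

definition Omega :: "nat \<Rightarrow> nat \<Rightarrow> 'k::comm_ring_1 mpoly \<Rightarrow> 'k mpoly" where
  "Omega i j f = partial (XV i) (partial (YV j) f) - partial (XV j) (partial (YV i) f)"

text \<open>Moving \<open>Delta\<close> past the x-derivatives leaves one correction for each of the
  two terms of \<open>Omega\<close>. Both corrections are the mixed second derivative in
  \<open>YV i\<close> and \<open>YV j\<close>, so the antisymmetry cancels them.\<close>

lemma Delta_Omega:
  assumes "i \<in> {1..n}" "j \<in> {1..n}"
  shows "Delta n (Omega i j f) = Omega i j (Delta n f)"
  by (simp add: Omega_def Delta_diff partial_y_Delta partial_x_Delta[OF assms(1)]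
      partial_x_Delta[OF assms(2)] partial_commute[of "YV i" "YV j"])

subsection \<open>Bihomogeneous polynomials\<close>

text \<open>Only indices from 1 to n are counted; for the monomials of a polynomial in
  \<open>KXY n\<close> this is the full bidegree in X and Y.\<close>

definition bideg :: "nat \<Rightarrow> (var \<Rightarrow>\<^sub>0 nat) \<Rightarrow> nat \<times> nat" where
  "bideg n m = (\<Sum>i = 1..n. Poly_Mapping.lookup m (XV i), \<Sum>i = 1..n. Poly_Mapping.lookup m (YV i))"

text \<open>The zero polynomial lies in this set for every pair \<open>a\<close>,
  \<open>b\<close>.\<close>

definition bihomogeneous :: "nat \<Rightarrow> nat \<Rightarrow> nat \<Rightarrow> 'k::zero mpoly set" where
  "bihomogeneous n a b = {f \<in> KXY n. \<forall>m \<in> Poly_Mapping.keys f. bideg n m = (a, b)}"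

lemma keys_partial:
  "Poly_Mapping.keys (partial v p) \<subseteq>
    {m - Poly_Mapping.single v 1 | m. m \<in> Poly_Mapping.keys p \<and> Poly_Mapping.lookup m v \<noteq> 0}"
proof
  fix k assume "k \<in> Poly_Mapping.keys (partial v p)"
  then have "k \<in> (\<Union>m\<in>Poly_Mapping.keys p.
      Poly_Mapping.keys (Poly_Mapping.single (m - Poly_Mapping.single v 1)
        (of_nat (Poly_Mapping.lookup m v) * Poly_Mapping.lookup p m)))"
    unfolding partial_def by (rule subsetD[OF keys_sum])
  then obtain m where m: "m \<in> Poly_Mapping.keys p"
    "k \<in> Poly_Mapping.keys (Poly_Mapping.single (m - Poly_Mapping.single v 1)
      (of_nat (Poly_Mapping.lookup m v) * Poly_Mapping.lookup p m))"
    by (rule UN_E)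
  then have "Poly_Mapping.lookup m v \<noteq> 0" "k = m - Poly_Mapping.single v 1"
    by (auto split: if_splits intro!: gr0I)
  then show "k \<in> {m - Poly_Mapping.single v 1 | m.
      m \<in> Poly_Mapping.keys p \<and> Poly_Mapping.lookup m v \<noteq> 0}"
    using m(1) by blast
qed

text \<open>The constructor is abstracted to an injective \<open>V\<close>, so that one proof serves
  both \<open>XV\<close> and \<open>YV\<close>.\<close>

lemma sum_lookup_minus_single:
  fixes n :: nat
  assumes "i \<in> {1..n}" "Poly_Mapping.lookup m (V i) \<noteq> (0::nat)" "inj V"
  shows "(\<Sum>j = 1..n. Poly_Mapping.lookup (m - Poly_Mapping.single (V i) 1) (V j)) =
    (\<Sum>j = 1..n. Poly_Mapping.lookup m (V j)) - 1"
proof -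
  have "(\<Sum>j = 1..n. Poly_Mapping.lookup m (V j)) =
      (\<Sum>j = 1..n. Poly_Mapping.lookup (m - Poly_Mapping.single (V i) 1) (V j) + (if i = j then 1 else 0))"
    using assms by (intro sum.cong) (auto simp: lookup_minus lookup_single when_def inj_eq)
  then show ?thesis
    using assms(1) by (simp add: sum.distrib)
qed

lemma bideg_minus_x:
  assumes "i \<in> {1..n}" "Poly_Mapping.lookup m (XV i) \<noteq> 0"
  shows "bideg n (m - Poly_Mapping.single (XV i) 1) = (fst (bideg n m) - 1, snd (bideg n m))"
  using sum_lookup_minus_single[of i n m XV] assms
  by (simp add: bideg_def inj_def lookup_minus lookup_single)

lemma bideg_minus_y:
  assumes "i \<in> {1..n}" "Poly_Mapping.lookup m (YV i) \<noteq> 0"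
  shows "bideg n (m - Poly_Mapping.single (YV i) 1) = (fst (bideg n m), snd (bideg n m) - 1)"
  using sum_lookup_minus_single[of i n m YV] assms
  by (simp add: bideg_def inj_def lookup_minus lookup_single)

lemma partial_in_KXY:
  assumes "f \<in> KXY n"
  shows "partial v f \<in> KXY n"
proof -
  have "Poly_Mapping.keys (m - Poly_Mapping.single v 1) \<subseteq> Poly_Mapping.keys m" for m :: "var \<Rightarrow>\<^sub>0 nat"
    by (auto simp: in_keys_iff lookup_minus)
  then show ?thesis
    using keys_partial[of v f] assms unfolding KXY_def by blast
qed

text \<open>The truncated \<open>a - 1\<close> is harmless: for \<open>a = 0\<close> no x-variable
  occurs in \<open>f\<close>, so the derivative is zero and has every bidegree.\<close>

lemma partial_x_bihomogeneous:
  assumes "f \<in> bihomogeneous n a b" "i \<in> {1..n}"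
  shows "partial (XV i) f \<in> bihomogeneous n (a - 1) b"
  using assms keys_partial[of "XV i" f]
  by (fastforce simp: bihomogeneous_def partial_in_KXY bideg_minus_x[unfolded One_nat_def])

lemma partial_y_bihomogeneous:
  assumes "f \<in> bihomogeneous n a b" "i \<in> {1..n}"
  shows "partial (YV i) f \<in> bihomogeneous n a (b - 1)"
  using assms keys_partial[of "YV i" f]
  by (fastforce simp: bihomogeneous_def partial_in_KXY bideg_minus_y[unfolded One_nat_def])

lemma bihomogeneous_diff:
  fixes f g :: "'k::comm_ring_1 mpoly"
  assumes "f \<in> bihomogeneous n a b" "g \<in> bihomogeneous n a b"
  shows "f - g \<in> bihomogeneous n a b"
  using assms keys_diff[of f g] unfolding bihomogeneous_def KXY_def by blast

lemma Omega_bihomogeneous: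
  assumes "f \<in> bihomogeneous n a b" "i \<in> {1..n}" "j \<in> {1..n}"
  shows "Omega i j f \<in> bihomogeneous n (a - 1) (b - 1)"
  using assms unfolding Omega_def
  by (intro bihomogeneous_diff partial_x_bihomogeneous partial_y_bihomogeneous)

section \<open>Euler's identities and Capelli's identity\<close>

lemma Var_mult_partial_single:
  "Var v * partial v (Poly_Mapping.single m c) =
    Poly_Mapping.single m (of_nat (Poly_Mapping.lookup m v) * (c :: 'k::comm_ring_1))"
proof (cases "Poly_Mapping.lookup m v = 0")
  case False
  then have "Poly_Mapping.single v 1 + (m - Poly_Mapping.single v 1) = m"
    by (intro poly_mapping_eqI) (auto simp: lookup_add lookup_minus lookup_single when_def)
  then show ?thesis
    by (simp add: Var_def partial_single mult_single)
qed (simp add: partial_single)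

text \<open>The operator \<open>Var v * partial v\<close> is diagonal on monomials, with the
  exponent of \<open>v\<close> as eigenvalue. Euler's identities then follow by comparing
  coefficients, the exponents adding up to the degree.\<close>

lemma lookup_Var_mult_partial:
  "Poly_Mapping.lookup (Var v * partial v f) m =
    of_nat (Poly_Mapping.lookup m v) * (Poly_Mapping.lookup f m :: 'k::comm_ring_1)"
proof (induction f rule: mpoly_induct)
  case (add k c p)
  then show ?case
    by (simp add: partial_add distrib_left lookup_add Var_mult_partial_single lookup_single when_def)
qed simp

lemma lookup_Const_mult:
  "Poly_Mapping.lookup (Const c * f) m = c * (Poly_Mapping.lookup f m :: 'k::comm_ring_1)"
  by (induction f rule: mpoly_induct)
    (simp_all add: Const_def distrib_left lookup_add mult_single lookup_single when_def)

lemma euler_x: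
  fixes f :: "'k::comm_ring_1 mpoly"
  assumes "f \<in> bihomogeneous n a b"
  shows "(\<Sum>i = 1..n. xvar i * partial (XV i) f) = Const (of_nat a) * f"
proof (rule poly_mapping_eqI)
  fix m
  show "Poly_Mapping.lookup (\<Sum>i = 1..n. xvar i * partial (XV i) f) m =
      Poly_Mapping.lookup (Const (of_nat a) * f) m"
    using assms by (cases "m \<in> Poly_Mapping.keys f")
      (auto simp: lookup_sum lookup_Var_mult_partial lookup_Const_mult bihomogeneous_def bideg_def
        in_keys_iff simp flip: sum_distrib_right of_nat_sum)
qed

lemma euler_y:
  fixes f :: "'k::comm_ring_1 mpoly"
  assumes "f \<in> bihomogeneous n a b"
  shows "(\<Sum>i = 1..n. yvar i * partial (YV i) f) = Const (of_nat b) * f"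
proof (rule poly_mapping_eqI)
  fix m
  show "Poly_Mapping.lookup (\<Sum>i = 1..n. yvar i * partial (YV i) f) m =
      Poly_Mapping.lookup (Const (of_nat b) * f) m"
    using assms by (cases "m \<in> Poly_Mapping.keys f")
      (auto simp: lookup_sum lookup_Var_mult_partial lookup_Const_mult bihomogeneous_def bideg_def
        in_keys_iff simp flip: sum_distrib_right of_nat_sum)
qed

lemma Const_add: "Const (c + d) = Const c + (Const d :: 'k::comm_ring_1 mpoly)"
  by (simp add: Const_def single_add)

lemma Const_mult: "Const (c * d) = Const c * (Const d :: 'k::comm_ring_1 mpoly)"
  by (simp add: Const_def mult_single)

lemma capelli:
  fixes f :: "'k::comm_ring_1 mpoly"
  assumes f: "f \<in> bihomogeneous n a b" and "Delta n f = 0"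
  shows "(\<Sum>i = 1..n. \<Sum>j = 1..n. uelem i j * Omega i j f) = Const (of_nat (2 * (a + 1) * b)) * f"
proof -
  \<comment> \<open>Half of the Capelli sum: only the term \<open>xvar i * yvar j\<close> of
    \<open>uelem i j\<close> is kept.\<close>
  define S where "S = (\<Sum>i = 1..n. \<Sum>j = 1..n. xvar i * yvar j * Omega i j f)"
  \<comment> \<open>Differentiating by \<open>YV j\<close> keeps the X-degree \<open>a\<close>, so
    Euler's identity in X applies to the derivative.\<close>
  have "(\<Sum>i = 1..n. xvar i * (yvar j * partial (XV i) (partial (YV j) f))) =
      Const (of_nat a) * (yvar j * partial (YV j) f)" if "j \<in> {1..n}" for j
    using euler_x[OF partial_y_bihomogeneous[OF f that]]
    by (simp add: mult.left_commute[of _ "yvar j"] flip: sum_distrib_left)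
  then have 1: "(\<Sum>j = 1..n. \<Sum>i = 1..n. xvar i * (yvar j * partial (XV i) (partial (YV j) f))) =
      Const (of_nat (a * b)) * f"
    using euler_y[OF f] by (simp add: Const_mult mult.assoc flip: sum_distrib_left)
  \<comment> \<open>After the derivatives are swapped, the sum over \<open>i\<close> is
    \<open>yvar j\<close> times \<open>Delta\<close> of the derivative by \<open>XV j\<close>; as
    \<open>Delta n f = 0\<close>, only the commutator survives.\<close>
  have "(\<Sum>i = 1..n. xvar i * (yvar j * partial (XV j) (partial (YV i) f))) =
      - (yvar j * partial (YV j) f)" if "j \<in> {1..n}" for j
  proof -
    have "Delta n (partial (XV j) f) = - partial (YV j) f"
      using partial_x_Delta[OF that, of f] assms(2) by (simp add: eq_neg_iff_add_eq_0)
    then show ?thesis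
      by (simp add: Delta_def mult.left_commute[of _ "yvar j"] partial_commute[of "XV j"]
          flip: sum_distrib_left)
  qed
  then have 2: "(\<Sum>j = 1..n. \<Sum>i = 1..n. xvar i * (yvar j * partial (XV j) (partial (YV i) f))) =
      - (Const (of_nat b) * f)"
    using euler_y[OF f] by (simp add: sum_negf)
  have "S = Const (of_nat (a * b)) * f + Const (of_nat b) * f"
    unfolding S_def Omega_def
    by (subst sum.swap) (simp only: right_diff_distrib sum_subtractf mult.assoc 1 2 diff_minus_eq_add)
  moreover have "(\<Sum>i = 1..n. \<Sum>j = 1..n. uelem i j * Omega i j f) = S + S"
  proof -
    \<comment> \<open>Since \<open>Omega\<close> is antisymmetric in its indices, the second term of
      \<open>uelem i j\<close> contributes the first one with \<open>i\<close> and \<open>j\<close>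
      exchanged.\<close>
    have "(\<Sum>i = 1..n. \<Sum>j = 1..n. uelem i j * Omega i j f) =
        S + (\<Sum>i = 1..n. \<Sum>j = 1..n. xvar j * yvar i * Omega j i f)"
      unfolding S_def sum.distrib[symmetric]
      by (intro sum.cong) (auto simp: uelem_def Omega_def algebra_simps)
    also have "(\<Sum>i = 1..n. \<Sum>j = 1..n. xvar j * yvar i * Omega j i f) = S"
      unfolding S_def by (rule sum.swap)
    finally show ?thesis .
  qed
  moreover have "2 * (a + 1) * b = (a * b + b) + (a * b + b)"
    by simp
  ultimately show ?thesis
    by (simp only: of_nat_add Const_add distrib_right)
qed

subsection \<open>Bihomogeneous components\<close>

definition component :: "nat \<Rightarrow> nat \<times> nat \<Rightarrow> 'k::zero mpoly \<Rightarrow> 'k mpoly" where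
  "component n d f = Poly_Mapping.mapp (\<lambda>m c. c when bideg n m = d) f"

lemma lookup_component:
  "Poly_Mapping.lookup (component n d f) m = (Poly_Mapping.lookup f m when bideg n m = d)"
  by (simp add: component_def lookup_mapp in_keys_iff when_def)

lemma component_zero [simp]: "component n d 0 = 0"
  by (intro poly_mapping_eqI) (simp add: lookup_component)

lemma component_add:
  fixes f g :: "'k::comm_monoid_add mpoly"
  shows "component n d (f + g) = component n d f + component n d g"
  by (intro poly_mapping_eqI) (simp add: lookup_component lookup_add when_add_distrib)

lemma component_sum:
  fixes g :: "'a \<Rightarrow> 'k::comm_monoid_add mpoly"
  shows "component n d (sum g I) = (\<Sum>i\<in>I. component n d (g i))"
  by (induction I rule: infinite_finite_induct) (auto simp: component_add)

lemma component_single: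
  "component n d (Poly_Mapping.single m c) = (if bideg n m = d then Poly_Mapping.single m c else 0)"
  by (intro poly_mapping_eqI) (auto simp: lookup_component lookup_single when_def)

lemma component_bihomogeneous:
  assumes "f \<in> KXY n"
  shows "component n (a, b) f \<in> bihomogeneous n a b"
proof -
  have "m \<in> Poly_Mapping.keys f \<and> bideg n m = (a, b)"
    if "m \<in> Poly_Mapping.keys (component n (a, b) f)" for m
    using that by (auto simp: in_keys_iff lookup_component when_def split: if_splits)
  then show ?thesis
    using assms unfolding bihomogeneous_def KXY_def by blast
qed

lemma sum_components:
  fixes f :: "'k::comm_monoid_add mpoly"
  shows "f = (\<Sum>d \<in> bideg n ` Poly_Mapping.keys f. component n d f)"
proof (rule poly_mapping_eqI)
  fix m
  show "Poly_Mapping.lookup f m =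
      Poly_Mapping.lookup (\<Sum>d \<in> bideg n ` Poly_Mapping.keys f. component n d f) m"
    by (cases "m \<in> Poly_Mapping.keys f")
      (auto simp: lookup_sum lookup_component when_def in_keys_iff)
qed

text \<open>\<open>Delta\<close> trades one y-variable for an x-variable and so shifts bidegrees by
  (1, -1). Writing the Y-degree as \<open>Suc b\<close> keeps the shift clear of truncated
  subtraction.\<close>

lemma Delta_component:
  fixes f :: "'k::comm_ring_1 mpoly"
  shows "Delta n (component n (a, Suc b) f) = component n (Suc a, b) (Delta n f)"
proof (induction f rule: mpoly_induct)
  case (add m c f)
  have term_eq: "xvar i * partial (YV i) (component n (a, Suc b) (Poly_Mapping.single m c)) =
      component n (Suc a, b) (xvar i * partial (YV i) (Poly_Mapping.single m c))"
    if i: "i \<in> {1..n}" for i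
  proof (cases "Poly_Mapping.lookup m (YV i) = 0")
    case False
    \<comment> \<open>The monomial that the i-th summand of \<open>Delta\<close> makes out of
      \<open>m\<close>.\<close>
    let ?k = "Poly_Mapping.single (XV i) 1 + (m - Poly_Mapping.single (YV i) 1)"
    have "bideg n ?k = (Suc (fst (bideg n m)), snd (bideg n m) - 1)"
      using bideg_minus_y[OF i False] bideg_minus_x[OF i, of ?k] i
      by (simp add: bideg_def lookup_add lookup_single sum.distrib when_def)
    \<comment> \<open>Hence the subtraction in the bidegree of \<open>?k\<close> is genuine and the
      shift can be inverted.\<close>
    moreover have "snd (bideg n m) \<noteq> 0"
      using False i by (auto simp: bideg_def)
    ultimately have "bideg n ?k = (Suc a, b) \<longleftrightarrow> bideg n m = (a, Suc b)"
      by (cases "bideg n m") auto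
    then show ?thesis
      by (simp add: component_single partial_single Var_def mult_single)
  qed (simp add: component_single partial_single)
  have "Delta n (component n (a, Suc b) (Poly_Mapping.single m c)) =
      component n (Suc a, b) (Delta n (Poly_Mapping.single m c))"
    using term_eq unfolding Delta_def component_sum by (intro sum.cong) auto
  then show ?case
    using add by (simp add: component_add Delta_add)
qed simp

subsection \<open>The algebra of constants\<close>

text \<open>Constancy is asked only for \<open>b > 0\<close>, the range that
  \<open>Delta_component\<close> covers; for \<open>b = 0\<close> membership follows from the
  absence of y-variables. All index pairs are allowed in \<open>uelem\<close>, since the Capelli sum
  runs over all of them.\<close>

lemma bihomogeneous_constant_in_subalgebra:
  fixes A :: "'k::field_char_0 mpoly set"
  assumes A: "subalgebra A"
    and x: "\<And>i. i \<in> {1..n} \<Longrightarrow> xvar i \<in> A"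
    and u: "\<And>i j. i \<in> {1..n} \<Longrightarrow> j \<in> {1..n} \<Longrightarrow> uelem i j \<in> A"
    and "f \<in> bihomogeneous n a b" "b > 0 \<Longrightarrow> Delta n f = 0"
  shows "f \<in> A"
  using assms(4,5)
proof (induction b arbitrary: a f)
  case 0
  have "Var v \<in> A" if m: "m \<in> Poly_Mapping.keys f" and v: "v \<in> Poly_Mapping.keys m" for m v
  proof -
    \<comment> \<open>The y-exponents are natural numbers with sum 0.\<close>
    have "v \<in> XV ` {1..n} \<union> YV ` {1..n}" "\<And>i. i \<in> {1..n} \<Longrightarrow> Poly_Mapping.lookup m (YV i) = 0"
      using 0(1) m v by (auto simp: bihomogeneous_def KXY_def bideg_def)
    then show ?thesis
      using v x by (auto simp: in_keys_iff)
  qed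
  then show ?case
    by (rule polynomial_in_subalgebra[OF A])
next
  case (Suc b)
  \<comment> \<open>Capelli's factor for Y-degree \<open>Suc b\<close>; it is nonzero, so
    characteristic 0 makes it invertible in the field.\<close>
  define k where "k = 2 * (a + 1) * Suc b"
  have "k \<noteq> 0"
    by (simp add: k_def)
  have "Delta n f = 0"
    using Suc.prems by simp
  have "Omega i j f \<in> A" if "i \<in> {1..n}" "j \<in> {1..n}" for i j
  proof (rule Suc.IH)
    show "Omega i j f \<in> bihomogeneous n (a - 1) b"
      using Omega_bihomogeneous[OF Suc.prems(1) that] by simp
    show "Delta n (Omega i j f) = 0"
      using Delta_Omega[OF that, of f] \<open>Delta n f = 0\<close> by (simp add: Omega_def)
  qed
  then have "(\<Sum>i = 1..n. \<Sum>j = 1..n. uelem i j * Omega i j f) \<in> A"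
    using A u by (intro subalgebra_sum subalgebra_mult)
  then have "Const (of_nat k) * f \<in> A"
    using capelli[OF Suc.prems(1) \<open>Delta n f = 0\<close>] by (simp add: k_def)
  then have "Const (inverse (of_nat k)) * (Const (of_nat k) * f) \<in> A"
    by (rule subalgebra_mult[OF A subalgebra_Const[OF A]])
  moreover have "Const (inverse (of_nat k)) * Const (of_nat k) = (1 :: 'k mpoly)"
    using \<open>k \<noteq> 0\<close> by (simp add: Const_def[of 1] flip: Const_mult)
  ultimately show ?case
    by (simp flip: mult.assoc)
qed

section \<open>The easy inclusion: the generators lie in the kernel of a derivation\<close>

lemma subalgebra_constants: "subalgebra (constants n :: 'k::comm_ring_1 mpoly set)"
proof -
  have "Const c \<in> KXY n" for c :: 'k
    by (simp add: KXY_def Const_def)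
  moreover have "p + q \<in> KXY n" if "p \<in> KXY n" "q \<in> KXY n" for p q :: "'k mpoly"
    using that Poly_Mapping.keys_add[of p q] unfolding KXY_def by blast
  moreover have "p * q \<in> KXY n" if "p \<in> KXY n" "q \<in> KXY n" for p q :: "'k mpoly"
    unfolding KXY_def
  proof safe
    fix m v assume "m \<in> Poly_Mapping.keys (p * q)" "v \<in> Poly_Mapping.keys m" "v \<notin> YV ` {1..n}"
    moreover from this obtain k l where "k \<in> Poly_Mapping.keys p" "l \<in> Poly_Mapping.keys q" "m = k + l"
      using keys_mult[of p q] by blast
    ultimately show "v \<in> XV ` {1..n}"
      using that Poly_Mapping.keys_add[of k l] unfolding KXY_def by blast
  qed
  ultimately show ?thesis
    by (auto simp: subalgebra_def constants_def Delta_add Delta_mult)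
qed

lemma Var_in_KXY: "v \<in> XV ` {1..n} \<union> YV ` {1..n} \<Longrightarrow> (Var v :: 'k::comm_ring_1 mpoly) \<in> KXY n"
  by (auto simp: KXY_def Var_def)

lemma xvar_in_constants:
  "i \<in> {1..n} \<Longrightarrow> (xvar i :: 'k::comm_ring_1 mpoly) \<in> constants n"
  by (simp add: constants_def Var_in_KXY)

lemma uelem_in_constants:
  assumes "i \<in> {1..n}" "j \<in> {1..n}"
  shows "(uelem i j :: 'k::comm_ring_1 mpoly) \<in> constants n"
proof -
  have "Poly_Mapping.keys (Poly_Mapping.single (XV i) 1 + Poly_Mapping.single (YV j) (1::nat))
      \<subseteq> XV ` {1..n} \<union> YV ` {1..n}" if "i \<in> {1..n}" "j \<in> {1..n}" for i j
    using that Poly_Mapping.keys_add[of "Poly_Mapping.single (XV i) 1" "Poly_Mapping.single (YV j) (1::nat)"]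
    by auto
  then have "xvar i * yvar j \<in> (KXY n :: 'k mpoly set)" if "i \<in> {1..n}" "j \<in> {1..n}" for i j
    using that by (simp add: KXY_def Var_def mult_single)
  then have "(uelem i j :: 'k mpoly) \<in> KXY n"
    using assms keys_diff[of "xvar i * yvar j :: 'k mpoly" "xvar j * yvar i"]
    unfolding uelem_def KXY_def by blast
  moreover have "Delta n (uelem i j :: 'k mpoly) = 0"
    using assms by (simp add: uelem_def Delta_diff Delta_mult del: atLeastAtMost_iff)
  ultimately show ?thesis
    by (simp add: constants_def)
qed

theorem theorem3:
  fixes n :: nat
  assumes "n \<ge> 1"
  shows "(constants n :: 'k::field_char_0 mpoly set) =
    subalgebra hull ({xvar i | i. 1 \<le> i \<and> i \<le> n} \<union> {uelem i j | i j. 1 \<le> i \<and> i < j \<and> j \<le> n})"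
    (is "_ = subalgebra hull ?S")
proof
  show "subalgebra hull ?S \<subseteq> (constants n :: 'k mpoly set)"
    by (rule hull_minimal)
      (auto intro!: subalgebra_constants xvar_in_constants uelem_in_constants)
next
  let ?A = "subalgebra hull ?S :: 'k mpoly set"
  note A = subalgebra_hull[of ?S]
  have x: "xvar i \<in> ?A" if "i \<in> {1..n}" for i
    using that by (intro hull_inc UnI1) auto
  have u_less: "uelem i j \<in> ?A" if "1 \<le> i" "i < j" "j \<le> n" for i j
    using that by (intro hull_inc UnI2 CollectI exI conjI) (rule refl)
  \<comment> \<open>Ordered pairs suffice: the diagonal elements vanish and exchanging the indices
    changes the sign.\<close>
  have u: "uelem i j \<in> ?A" if "i \<in> {1..n}" "j \<in> {1..n}" for i j
  proof (cases i j rule: linorder_cases)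
    case less
    then show ?thesis using that by (intro u_less) auto
  next
    case equal
    then show ?thesis using subalgebra_0[OF A] by (simp add: uelem_def)
  next
    case greater
    then have "uelem j i \<in> ?A" using that by (intro u_less) auto
    then have "- uelem j i \<in> ?A" by (rule subalgebra_uminus[OF A])
    then show ?thesis by (simp add: uelem_def)
  qed
  show "constants n \<subseteq> ?A"
  proof
    fix f :: "'k mpoly"
    assume f: "f \<in> constants n"
    have "component n d f \<in> ?A" for d
    proof (cases d)
      case (Pair a b)
      \<comment> \<open>It equals the component of \<open>Delta n f = 0\<close> in bidegree
        \<open>(Suc a, b - 1)\<close>.\<close>
      have "Delta n (component n (a, b) f) = 0" if "b > 0"
        using that f Delta_component[of n a "b - 1" f] by (simp add: constants_def)
      then show ?thesis
        using f component_bihomogeneous[of f n a b]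
        unfolding Pair by (intro bihomogeneous_constant_in_subalgebra[OF A x u]) (auto simp: constants_def)
    qed
    then have "(\<Sum>d \<in> bideg n ` Poly_Mapping.keys f. component n d f) \<in> ?A"
      by (intro subalgebra_sum[OF A])
    then show "f \<in> ?A"
      by (simp flip: sum_components)
  qed
qed

end
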